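(* Let $n\geq 1$ and suppose a deck of $n$ cards is given one single-shelf shuffle, and the player is given complete feedback. Consider the following strategy. In position $1$, guess card $1$. In every position $j+1\geq 2$ such that neither card $n-1$ nor card $n$ has been shown in positions $1,\dots,j$, guess the card $r_j+1$, where $r_j$ is the card shown in position $j$. Once a card of $\{n-1,n\}$ has first been shown, guess the remaining (not yet shown) cards in descending order. Then this strategy is optimal, i.e. it maximizes the expected number of correct guesses among all complete-feedback guessing strategies; moreover, all the guesses made after the first appearance of a card of $\{n-1,n\}$ are correct with probability $1$.
   Context: Single-shelf shuffle: a deck of cards is initially labeled $1,2,\dots,n$ from top to bottom. Cards are drawn one at a time from the bottom of the deck (card $n$ first, card $1$ last) and placed in a pile; each drawn card is placed, independently, on the top or at the bottom of the existing pile with probability $1/2$ each. The final pile is the shuffled deck; position $1$ is its top, and $r_j$ denotes the card in position $j$. Complete feedback: the player guesses the cards in positions $1,2,\dots,n$ in order, and after each guess the card in that position is turned face up. A complete-feedback guessing strategy is a rule $(g_1,\dots,g_n)$ in which the guess $g_{j+1}\in\{1,\dots,n\}$ is a function of $(r_1,\dots,r_j)$ (and $g_1$ is a constant). The guess in position $j$ is correct if $g_j=r_j$. *)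

theory Defs
  imports "HOL-Probability.Probability_Mass_Function"
begin

text \<open>
  Decks and piles are lists from top to bottom. The recursion draws from the bottom of the deck:
  the top card \<open>x\<close> is drawn last, when the other cards already form a pile.
\<close>

fun single_shelf_shuffle :: "'a list \<Rightarrow> 'a list pmf" where
  "single_shelf_shuffle [] = return_pmf []"
| "single_shelf_shuffle (x # deck) =
     bind_pmf (single_shelf_shuffle deck) (\<lambda>pile.
     bind_pmf (bernoulli_pmf (1/2)) (\<lambda>on_top.
     return_pmf (if on_top then x # pile else pile @ [x])))"

definition shuffled_deck :: "nat \<Rightarrow> nat list pmf" where
  "shuffled_deck n = single_shelf_shuffle [1..<n + 1]"

text \<open>
  A strategy is one function on histories: the guess $g_{j+1}(r_1,\dots,r_j)$ is
  \<open>g [r\<^sub>1, \<dots>, r\<^sub>j]\<close>, and $g_1$ is \<open>g []\<close>. Only histories of fewer than \<open>n\<close> cards matter.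
\<close>

definition complete_feedback_strategy :: "nat \<Rightarrow> (nat list \<Rightarrow> nat) \<Rightarrow> bool" where
  "complete_feedback_strategy n g \<longleftrightarrow>
     (\<forall>h. length h < n \<and> set h \<subseteq> {1..n} \<longrightarrow> g h \<in> {1..n})"

text \<open>List indices start at 0, so index \<open>j\<close> of \<open>rs\<close> is position \<open>j + 1\<close> of the deck.\<close>

definition correct_guess :: "(nat list \<Rightarrow> nat) \<Rightarrow> nat list \<Rightarrow> nat \<Rightarrow> bool" where
  "correct_guess g rs j \<longleftrightarrow> g (take j rs) = rs ! j"

definition num_correct :: "nat \<Rightarrow> (nat list \<Rightarrow> nat) \<Rightarrow> nat list \<Rightarrow> nat" where
  "num_correct n g rs = card {j. j < n \<and> correct_guess g rs j}"

definition expected_correct :: "nat \<Rightarrow> (nat list \<Rightarrow> nat) \<Rightarrow> real" where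
  "expected_correct n g =
     measure_pmf.expectation (shuffled_deck n) (\<lambda>rs. real (num_correct n g rs))"

definition optimal_strategy :: "nat \<Rightarrow> (nat list \<Rightarrow> nat) \<Rightarrow> bool" where
  "optimal_strategy n g \<longleftrightarrow>
     complete_feedback_strategy n g \<and>
     (\<forall>g'. complete_feedback_strategy n g' \<longrightarrow> expected_correct n g' \<le> expected_correct n g)"

text \<open>For \<open>n = 1\<close>, \<open>n - 1 = 0\<close> is not the label of a card, so the condition only concerns card 1.\<close>

definition high_card_shown :: "nat \<Rightarrow> nat list \<Rightarrow> bool" where
  "high_card_shown n h \<longleftrightarrow> n - 1 \<in> set h \<or> n \<in> set h"

text \<open>Guessing the remaining cards in descending order: each time the largest card not yet shown.\<close>

definition successor_strategy :: "nat \<Rightarrow> nat list \<Rightarrow> nat" where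
  "successor_strategy n h =
     (if h = [] then 1
      else if \<not> high_card_shown n h then last h + 1
      else Max ({1..n} - set h))"

end

theory Submission
  imports Defs
begin

text \<open>
  Condition on the top card \<open>x\<close> of the unshuffled deck, which ends up on top or at the bottom of
  the pile of the other \<open>m\<close> cards. In either case the rest of the play is a play on that pile. In
  the second case a first guess \<open>x\<close> is wasted, and the last guess can always be correct. So the best
  expected score is determined recursively together with the best expected score of a player who
  wastes the first guess. The first guess \<open>x\<close> gains 1 if \<open>x\<close> is on top, and otherwise loses at most
  1, hence it is optimal. The successor strategy follows this recursion: it guesses the smallest
  card that can still be on top.
\<close>

section \<open>Correct guesses along a pile\<close>

text \<open>Recursion on the pile replaces the strategy by its continuation after the card shown,
  which suits inductions over arbitrary \<open>g\<close>.\<close>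

fun hits :: "('a list \<Rightarrow> 'a) \<Rightarrow> 'a list \<Rightarrow> nat" where
  "hits g [] = 0"
| "hits g (r # rs) = of_bool (g [] = r) + hits (\<lambda>h. g (r # h)) rs"

lemma hits_snoc: "hits g (rs @ [x]) = hits g rs + of_bool (g rs = x)"
  by (induction rs arbitrary: g) auto

lemma hits_eq_card: "hits g rs = card {j. j < length rs \<and> g (take j rs) = rs ! j}"
proof (induction rs rule: rev_induct)
  case (snoc x rs)
  have "{j. j < length (rs @ [x]) \<and> g (take j (rs @ [x])) = (rs @ [x]) ! j} =
      {j. j < length rs \<and> g (take j rs) = rs ! j} \<union> (if g rs = x then {length rs} else {})"
    by (auto simp: nth_append less_Suc_eq)
  then show ?case
    using snoc by (simp add: hits_snoc)
qed simp

section \<open>The shuffle conditioned on the top card\<close>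

lemma set_pmf_single_shelf_shuffle_Cons:
  "set_pmf (single_shelf_shuffle (x # deck)) =
     (#) x ` set_pmf (single_shelf_shuffle deck) \<union>
     (\<lambda>pile. pile @ [x]) ` set_pmf (single_shelf_shuffle deck)"
  by (auto simp: set_pmf_bernoulli ex_bool_eq)

lemma finite_set_pmf_single_shelf_shuffle [simp]:
  "finite (set_pmf (single_shelf_shuffle deck))"
  by (induction deck) (simp_all add: set_pmf_single_shelf_shuffle_Cons del: single_shelf_shuffle.simps(2))

lemma mset_single_shelf_shuffle:
  "rs \<in> set_pmf (single_shelf_shuffle deck) \<Longrightarrow> mset rs = mset deck"
  by (induction deck arbitrary: rs)
    (auto simp: set_pmf_single_shelf_shuffle_Cons simp del: single_shelf_shuffle.simps(2))

text \<open>The coin for \<open>x\<close> is independent of the pile below it, so it may be tossed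
  first.\<close>

lemma expectation_single_shelf_shuffle_Cons:
  fixes f :: "'a list \<Rightarrow> real"
  shows "measure_pmf.expectation (single_shelf_shuffle (x # deck)) f =
    (measure_pmf.expectation (single_shelf_shuffle deck) (\<lambda>pile. f (x # pile)) +
     measure_pmf.expectation (single_shelf_shuffle deck) (\<lambda>pile. f (pile @ [x]))) / 2"
proof -
  have "single_shelf_shuffle (x # deck) =
      bind_pmf (bernoulli_pmf (1/2)) (\<lambda>on_top.
        map_pmf (\<lambda>pile. if on_top then x # pile else pile @ [x]) (single_shelf_shuffle deck))"
    by (simp add: map_pmf_def bind_commute_pmf[of "single_shelf_shuffle deck"])
  then show ?thesis
    by (simp add: pmf_expectation_bind[where A = UNIV] UNIV_bool add_divide_distrib
        del: single_shelf_shuffle.simps(2))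
qed

section \<open>Upper bound for all strategies\<close>

text \<open>
  Best expected score with \<open>m\<close> cards, where \<open>b\<close> tells whether the first guess is used; if it is
  not, then it names no card of the deck.
\<close>

definition best_score :: "bool \<Rightarrow> nat \<Rightarrow> real" where
  "best_score b m = (if m = 1 then of_bool b else (3 * real m - 2 + 2 * of_bool b) / 4)"

lemma best_score_1 [simp]: "best_score b (Suc 0) = of_bool b"
  by (simp add: best_score_def)

text \<open>Average of two cases: with the top card on top, the first guess scores if used and a
  full play follows; with it at the bottom, the first guess is wasted on the other cards and the
  last guess is correct.\<close>

lemma best_score_Suc:
  "m \<ge> 1 \<Longrightarrow>
    best_score b (Suc m) = (of_bool b + best_score True m + best_score False m + 1) / 2"
  by (auto simp: best_score_def field_simps)

lemma best_score_mono: "best_score b m \<le> best_score True m"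
  by (auto simp: best_score_def)

lemma best_score_True_le: "best_score True m \<le> best_score False m + 1"
  by (auto simp: best_score_def field_simps)

lemma expectation_hits_le:
  assumes "distinct deck" "deck \<noteq> []"
  shows "measure_pmf.expectation (single_shelf_shuffle deck) (\<lambda>rs. real (hits g rs))
    \<le> best_score (g [] \<in> set deck) (length deck)"
  using assms
proof (induction deck arbitrary: g)
  case (Cons x deck)
  show ?case
  proof (cases "deck = []")
    case True
    then show ?thesis
      by (simp add: expectation_single_shelf_shuffle_Cons del: single_shelf_shuffle.simps(2))
  next
    case False
    let ?E = "measure_pmf.expectation (single_shelf_shuffle deck)"
    let ?m = "length deck"
    note int = integrable_measure_pmf_finite[OF finite_set_pmf_single_shelf_shuffle]
    have IH: "?E (\<lambda>rs. real (hits g' rs)) \<le> best_score (g' [] \<in> set deck) ?m" for g'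
      using Cons False by simp
    have top: "?E (\<lambda>pile. real (hits g (x # pile))) \<le> of_bool (g [] = x) + best_score True ?m"
      using IH[of "\<lambda>h. g (x # h)"] best_score_mono[of _ ?m]
      by (simp add: int order_trans)
    have "?E (\<lambda>pile. real (hits g (pile @ [x]))) \<le> ?E (\<lambda>pile. real (hits g pile) + 1)"
      by (intro integral_mono int) (simp add: hits_snoc)
    also have "\<dots> \<le> best_score (g [] \<in> set deck) ?m + 1"
      using IH[of g] by (simp add: int)
    finally have bottom:
      "?E (\<lambda>pile. real (hits g (pile @ [x]))) \<le> best_score (g [] \<in> set deck) ?m + 1" .
    have "?m \<ge> 1"
      using False by (simp add: Suc_le_eq)
    \<comment> \<open>By distinctness a first guess \<open>x\<close> is not in \<open>deck\<close>,
      hence wasted if \<open>x\<close> goes to the bottom. A first guess in \<open>deck\<close>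
      scores nothing if \<open>x\<close> is on top, and its gain in the other case is at most 1 by
      \<open>best_score_True_le\<close>.\<close>
    show ?thesis
      using top bottom best_score_True_le[of ?m] Cons.prems
      by (auto simp: expectation_single_shelf_shuffle_Cons best_score_Suc[OF \<open>?m \<ge> 1\<close>]
          simp del: single_shelf_shuffle.simps(2) hits.simps)
  qed
qed simp

section \<open>Play of the successor strategy\<close>

lemma set_single_shelf_shuffle_upt:
  assumes "rs \<in> set_pmf (single_shelf_shuffle [a..<Suc n])"
  shows "set rs = {a..n}"
  using mset_eq_setD[OF mset_single_shelf_shuffle[OF assms]]
  by (simp add: atLeastLessThanSuc_atLeastAtMost del: upt_Suc)

lemma not_high_card_shown:
  assumes "set h \<subseteq> {1..<a}" "a < n"
  shows "\<not> high_card_shown n h"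
proof -
  have "x < n - 1" if "x \<in> set h" for x
    using assms that by fastforce
  then show ?thesis
    unfolding high_card_shown_def by fastforce
qed

text \<open>All cards above \<open>a\<close> are shown and \<open>a\<close> is not, so the
  descending rule picks \<open>a\<close>.\<close>

lemma successor_strategy_last:
  assumes "set p \<subseteq> {1..<a}" "1 \<le> a" "a \<le> n" "high_card_shown n h" "h \<noteq> []"
    and "set h = set p \<union> {a<..n}"
  shows "successor_strategy n h = a"
proof -
  have "Max ({1..n} - set h) = a"
    using assms by (intro Max_eqI) fastforce+
  then show ?thesis
    using assms by (simp add: successor_strategy_def)
qed

lemma successor_strategy_snoc:
  assumes "set p \<subseteq> {1..<a}" "1 \<le> a" "a < n"
  shows "successor_strategy n (p @ [a]) = Suc a"
\<comment> \<open>If \<open>a\<close> is \<open>n - 1\<close>, the descending rule already applies,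
  and it agrees with the successor rule because \<open>n\<close> is still hidden.\<close>
proof (cases "Suc a = n")
  case True
  then show ?thesis
    using assms by (intro successor_strategy_last[of "p @ [a]"]) (auto simp: high_card_shown_def)
next
  case False
  then have "\<not> high_card_shown n (p @ [a])"
    using assms by (intro not_high_card_shown[of _ "Suc a"]) auto
  then show ?thesis
    by (simp add: successor_strategy_def)
qed

lemma successor_strategy_bottom:
  assumes "set p \<subseteq> {1..<a}" "1 \<le> a" "a < n"
    and "pile \<in> set_pmf (single_shelf_shuffle [Suc a..<Suc n])"
  shows "successor_strategy n (p @ pile) = a"
proof -
  have "set pile = {Suc a..n}"
    using assms by (intro set_single_shelf_shuffle_upt)
  then show ?thesis
    using assms by (intro successor_strategy_last[of p]) (auto simp: high_card_shown_def)
qed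

text \<open>
  Here \<open>p\<close> lists cards shown before the cards \<open>a, \<dots>, n\<close> are played, so the cards below \<open>a\<close> and
  outside \<open>p\<close> come later. The first guess is left free, since it is wasted if \<open>a - 1\<close> went to the
  bottom.
\<close>

lemma expectation_hits_successor_strategy:
  assumes "set p \<subseteq> {1..<a}" "1 \<le> a" "a \<le> n"
    and "\<And>h. h \<noteq> [] \<Longrightarrow> g h = successor_strategy n (p @ h)" "g [] \<notin> {a<..n}"
  shows "measure_pmf.expectation (single_shelf_shuffle [a..<Suc n]) (\<lambda>rs. real (hits g rs))
    = best_score (g [] = a) (Suc n - a)"
  using assms(3,1,2,4,5)
proof (induction a arbitrary: p g rule: inc_induct)
  case base
  then show ?case
    by (simp add: expectation_single_shelf_shuffle_Cons del: single_shelf_shuffle.simps(2))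
next
  case (step a)
  let ?E = "measure_pmf.expectation (single_shelf_shuffle [Suc a..<Suc n])"
  let ?m = "n - a"
  note int = integrable_measure_pmf_finite[OF finite_set_pmf_single_shelf_shuffle]
  \<comment> \<open>With \<open>a\<close> on top, it joins the shown cards \<open>p\<close>.\<close>
  have "?E (\<lambda>pile. real (hits (\<lambda>h. g (a # h)) pile)) = best_score (g [a] = Suc a) ?m"
    using step.prems step.hyps step.IH[of "p @ [a]" "\<lambda>h. g (a # h)"]
    by (force simp: successor_strategy_snoc)
  moreover have "g [a] = Suc a"
    using step.prems step.hyps by (simp add: successor_strategy_snoc)
  ultimately have top:
    "?E (\<lambda>pile. real (hits g (a # pile))) = of_bool (g [] = a) + best_score True ?m"
    by (simp add: int)
  have "?E (\<lambda>pile. real (hits g (pile @ [a]))) = ?E (\<lambda>pile. real (hits g pile) + 1)"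
  proof (intro integral_cong_AE AE_pmfI)
    fix pile assume pile: "pile \<in> set_pmf (single_shelf_shuffle [Suc a..<Suc n])"
    then have "pile \<noteq> []"
      using set_single_shelf_shuffle_upt[OF pile] step.hyps by auto
    then have "g pile = a"
      using step.prems(3) successor_strategy_bottom[OF step.prems(1,2) _ pile] step.hyps by simp
    then show "real (hits g (pile @ [a])) = real (hits g pile) + 1"
      by (simp add: hits_snoc)
  qed simp_all
  also have "\<dots> = best_score (g [] = Suc a) ?m + 1"
    using step.prems step.hyps step.IH[of p g] by (force simp: int)
  \<comment> \<open>The free first guess is at most \<open>a\<close> or above \<open>n\<close>, so
    it misses the whole pile.\<close>
  also have "(g [] = Suc a) = False"
    using step.prems step.hyps by auto
  finally have bottom: "?E (\<lambda>pile. real (hits g (pile @ [a]))) = best_score False ?m + 1" .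
  have "[a..<Suc n] = a # [Suc a..<Suc n]" "Suc n - a = Suc ?m" "?m \<ge> 1"
    using step.hyps by (simp_all add: upt_conv_Cons)
  then show ?case
    using top bottom
    by (simp add: expectation_single_shelf_shuffle_Cons best_score_Suc
        del: single_shelf_shuffle.simps(2) hits.simps upt_Suc)
qed

text \<open>Same recursion: a card at the bottom is guessed by
  \<open>successor_strategy_bottom\<close>, and all other positions are left to the smaller
  pile.\<close>

lemma successor_strategy_correct:
  assumes "set p \<subseteq> {1..<a}" "1 \<le> a" "a \<le> n"
    and "rs \<in> set_pmf (single_shelf_shuffle [a..<Suc n])" "j < length rs"
    and "high_card_shown n (p @ take j rs)"
  shows "successor_strategy n (p @ take j rs) = rs ! j"
  using assms(3,1,2,4-6)
proof (induction a arbitrary: p rs j rule: inc_induct)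
  case base
  then have rs: "rs = [n]" "j = 0"
    by (auto simp: bind_return_pmf split: if_splits)
  \<comment> \<open>The high card shown must lie in \<open>p\<close>, which rules out the opening
    guess 1.\<close>
  moreover have "p \<noteq> []"
    using base rs by (auto simp: high_card_shown_def)
  ultimately show ?case
    using base by (auto intro!: successor_strategy_last[of p])
next
  case (step a)
  have "[a..<Suc n] = a # [Suc a..<Suc n]"
    using step.hyps by (simp add: upt_conv_Cons)
  with step.prems(3) have "rs \<in> set_pmf (single_shelf_shuffle (a # [Suc a..<Suc n]))"
    by (simp only:)
  then obtain pile where pile: "pile \<in> set_pmf (single_shelf_shuffle [Suc a..<Suc n])"
    and "rs = a # pile \<or> rs = pile @ [a]"
    unfolding set_pmf_single_shelf_shuffle_Cons by blast
  then consider "rs = a # pile" | "rs = pile @ [a]"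
    by blast
  then show ?case
  proof cases
    case 1
    \<comment> \<open>No high card precedes \<open>a\<close>, so position \<open>j\<close> lies in
      the pile after it.\<close>
    have "\<not> high_card_shown n p"
      using step.prems step.hyps by (intro not_high_card_shown)
    then obtain i where "j = Suc i"
      using step.prems by (cases j) auto
    then show ?thesis
      using step.IH[of "p @ [a]" pile i] step.prems step.hyps pile 1 by force
  next
    case 2
    show ?thesis
    proof (cases "j < length pile")
      case True
      then show ?thesis
        using step.IH[of p pile j] step.prems step.hyps pile 2 by (force simp: nth_append)
    next
      case False
      then show ?thesis
        using step.prems step.hyps pile 2 successor_strategy_bottom[of p a n pile]
        by (simp add: nth_append less_Suc_eq)
    qed
  qed
qed

section \<open>Admissibility and optimality\<close>

lemma complete_feedback_successor_strategy:
  assumes "n \<ge> 1"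
  shows "complete_feedback_strategy n (successor_strategy n)"
  unfolding complete_feedback_strategy_def
proof (intro allI impI)
  fix h :: "nat list"
  assume h: "length h < n \<and> set h \<subseteq> {1..n}"
  have "card (set h) < card {1..n}"
    using h card_length[of h] by simp
  then have "{1..n} - set h \<noteq> {}"
    using card_mono[of "set h" "{1..n}"] by auto
  then have "Max ({1..n} - set h) \<in> {1..n} - set h"
    by (intro Max_in) auto
  moreover have "last h < n" if "h \<noteq> []" "\<not> high_card_shown n h"
  proof -
    have "last h \<in> set h"
      using that by simp
    then have "last h \<in> {1..n}" "last h \<noteq> n"
      using that h unfolding high_card_shown_def by blast+
    then show ?thesis
      by simp
  qed
  ultimately show "successor_strategy n h \<in> {1..n}"
    using assms by (auto simp: successor_strategy_def Suc_le_eq)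
qed

lemma expected_correct_eq:
  "expected_correct n g =
    measure_pmf.expectation (single_shelf_shuffle [1..<Suc n]) (\<lambda>rs. real (hits g rs))"
  unfolding expected_correct_def shuffled_deck_def Suc_eq_plus1[symmetric]
proof (intro integral_cong_AE AE_pmfI)
  fix rs assume "rs \<in> set_pmf (single_shelf_shuffle [1..<Suc n])"
  then have "length rs = n"
    using mset_eq_length[OF mset_single_shelf_shuffle] by fastforce
  then show "real (num_correct n g rs) = real (hits g rs)"
    by (simp add: num_correct_def correct_guess_def hits_eq_card)
qed simp_all

theorem theorem1p4:
  fixes n :: nat
  assumes "n \<ge> 1"
  shows "optimal_strategy n (successor_strategy n) \<and>
    measure_pmf.prob (shuffled_deck n)
      {rs. \<forall>j<n. high_card_shown n (take j rs) \<longrightarrow> correct_guess (successor_strategy n) rs j} = 1"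
proof
  have "expected_correct n g \<le> expected_correct n (successor_strategy n)" for g
  proof -
    have "expected_correct n g \<le> best_score (g [] \<in> set [1..<Suc n]) n"
      using expectation_hits_le[of "[1..<Suc n]" g] assms by (simp add: expected_correct_eq del: upt_Suc)
    also have "\<dots> \<le> best_score True n"
      by (rule best_score_mono)
    \<comment> \<open>The bound is attained because the opening guess 1 is the smallest
      card.\<close>
    also have "\<dots> = expected_correct n (successor_strategy n)"
      using expectation_hits_successor_strategy[of "[]" 1 n "successor_strategy n"] assms
      by (simp add: expected_correct_eq successor_strategy_def del: upt_Suc)
    finally show ?thesis .
  qed
  then show "optimal_strategy n (successor_strategy n)"
    using complete_feedback_successor_strategy[OF assms] by (simp add: optimal_strategy_def)
  have "correct_guess (successor_strategy n) rs j"
    if "rs \<in> set_pmf (shuffled_deck n)" "j < n" "high_card_shown n (take j rs)" for rs j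
  proof -
    have rs: "rs \<in> set_pmf (single_shelf_shuffle [1..<Suc n])"
      using that by (simp add: shuffled_deck_def)
    then have "length rs = n"
      using mset_eq_length[OF mset_single_shelf_shuffle] by fastforce
    then show ?thesis
      using successor_strategy_correct[of "[]" 1 n rs j] rs that assms
      by (simp add: correct_guess_def)
  qed
  then show "measure_pmf.prob (shuffled_deck n)
      {rs. \<forall>j<n. high_card_shown n (take j rs) \<longrightarrow> correct_guess (successor_strategy n) rs j} = 1"
    by (subst measure_pmf.prob_eq_1) (auto intro: AE_pmfI)
qed

end
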